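(* Let $F(X)=\frac{1+|X|^2}{2}$ for $X\in\mathbb{R}^m$ and $\lambda(Y)=\frac{1+|Y|^2}{2}$ for $Y\in\mathbb{R}^n$. Let $A$ be a real $n\times m$ matrix with rows $A^1,\ldots,A^n$, and let $\varphi:(\mathbb{R}^{m},F^{-2}\delta_{ij})\equiv(S^{m}\setminus\{N\},g_{can})\to(\mathbb{R}^{n},\lambda^{-2}\delta_{ij})\equiv(S^{n}\setminus\{N\},g_{can})$ be the linear map $\varphi(X)=AX=(A^{1}X,\cdots,A^{n}X)$ between two (punctured) spheres. Then $\varphi$ is $\infty$-harmonic if and only if $A=0$, i.e., $\varphi$ is a constant map, or $A^tA=I_{m\times m}$, i.e., $\varphi$ is an isometric immersion.
   Context: A smooth map $\varphi:(M,g)\to(N,h)$ between Riemannian manifolds is called $\infty$-harmonic if $\tfrac12\,{\rm d}\varphi({\rm grad}\,|{\rm d}\varphi|^2)=0$ on $M$, where $|{\rm d}\varphi|^2={\rm Trace}_g\,\varphi^*h$ is the energy density of $\varphi$ and the gradient is taken with respect to $g$. The $k$-sphere with its standard metric minus a point, $(S^{k}\setminus\{N\},g_{can})$, is identified (via stereographic projection) with $\mathbb{R}^k$ endowed with the metric $\left(\frac{1+|x|^2}{2}\right)^{-2}\delta_{ij}$. *)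

theory Defs
  imports "HOL-Analysis.Analysis"
begin

text \<open>
  Riemannian manifolds covered by a single global chart \<open>real ^ 'm\<close>: a metric is the field
  \<open>g\<close> of its coordinate matrices \<open>g x $ i $ j\<close>. The notions below have their geometric meaning
  when \<open>g\<close> and \<open>h\<close> are smooth with symmetric positive definite values.
\<close>

primrec Ck_map :: "nat \<Rightarrow> ('a::real_normed_vector \<Rightarrow> 'b::real_normed_vector) \<Rightarrow> bool" where
  "Ck_map 0 f \<longleftrightarrow> continuous_on UNIV f"
| "Ck_map (Suc k) f \<longleftrightarrow>
     f differentiable_on UNIV \<and> (\<forall>v. Ck_map k (\<lambda>x. frechet_derivative f (at x) v))"

definition smooth_map :: "('a::real_normed_vector \<Rightarrow> 'b::real_normed_vector) \<Rightarrow> bool" where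
  "smooth_map f \<longleftrightarrow> (\<forall>k. Ck_map k f)"

definition pullback_metric ::
  "(real ^ 'n \<Rightarrow> real ^ 'n ^ 'n) \<Rightarrow> (real ^ 'm \<Rightarrow> real ^ 'n) \<Rightarrow> real ^ 'm \<Rightarrow> real ^ 'm ^ 'm" where
  "pullback_metric h \<phi> x = (\<chi> i j.
     frechet_derivative \<phi> (at x) (axis i 1) \<bullet>
       (h (\<phi> x) *v frechet_derivative \<phi> (at x) (axis j 1)))"

text \<open>The trace \<open>g\<^sup>i\<^sup>j (\<phi>\<^sup>* h)\<^sub>i\<^sub>j\<close> with respect to \<open>g\<close>.\<close>

definition energy_density ::
  "(real ^ 'm \<Rightarrow> real ^ 'm ^ 'm) \<Rightarrow> (real ^ 'n \<Rightarrow> real ^ 'n ^ 'n) \<Rightarrow>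
   (real ^ 'm \<Rightarrow> real ^ 'n) \<Rightarrow> real ^ 'm \<Rightarrow> real" where
  "energy_density g h \<phi> x = trace (matrix_inv (g x) ** pullback_metric h \<phi> x)"

text \<open>The vector field with components \<open>g\<^sup>i\<^sup>j \<partial>\<^sub>j f\<close>.\<close>

definition riemannian_grad ::
  "(real ^ 'm \<Rightarrow> real ^ 'm ^ 'm) \<Rightarrow> (real ^ 'm \<Rightarrow> real) \<Rightarrow> real ^ 'm \<Rightarrow> real ^ 'm" where
  "riemannian_grad g f x = matrix_inv (g x) *v (\<chi> j. frechet_derivative f (at x) (axis j 1))"

definition infinity_harmonic ::
  "(real ^ 'm \<Rightarrow> real ^ 'm ^ 'm) \<Rightarrow> (real ^ 'n \<Rightarrow> real ^ 'n ^ 'n) \<Rightarrow>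
   (real ^ 'm \<Rightarrow> real ^ 'n) \<Rightarrow> bool" where
  "infinity_harmonic g h \<phi> \<longleftrightarrow> smooth_map \<phi> \<and>
     (\<forall>x. (1 / 2) *\<^sub>R
        frechet_derivative \<phi> (at x) (riemannian_grad g (energy_density g h \<phi>) x) = 0)"

definition isometric_immersion ::
  "(real ^ 'm \<Rightarrow> real ^ 'm ^ 'm) \<Rightarrow> (real ^ 'n \<Rightarrow> real ^ 'n ^ 'n) \<Rightarrow>
   (real ^ 'm \<Rightarrow> real ^ 'n) \<Rightarrow> bool" where
  "isometric_immersion g h \<phi> \<longleftrightarrow> smooth_map \<phi> \<and>
     (\<forall>x. inj (frechet_derivative \<phi> (at x))) \<and> (\<forall>x. pullback_metric h \<phi> x = g x)"

text \<open>
  Stereographic projection from \<open>N\<close> turns the standard metric of the unit sphere minus \<open>N\<close>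
  into \<open>stereo_factor\<^sup>-\<^sup>2 \<delta>\<^sub>i\<^sub>j\<close>.
\<close>

definition stereo_factor :: "real ^ 'k \<Rightarrow> real" where
  "stereo_factor x = (1 + (norm x)\<^sup>2) / 2"

definition punctured_sphere_metric :: "real ^ 'k \<Rightarrow> real ^ 'k ^ 'k" where
  "punctured_sphere_metric x = (stereo_factor x powi (-2)) *\<^sub>R mat 1"

lemma punctured_sphere_metric_symmetric:
  "transpose (punctured_sphere_metric x) = punctured_sphere_metric x"
  by (simp add: punctured_sphere_metric_def vec_eq_iff transpose_def mat_def)

lemma punctured_sphere_metric_pos_def:
  assumes "v \<noteq> 0"
  shows "v \<bullet> (punctured_sphere_metric x *v v) > 0"
proof -
  have "1 + (norm x)\<^sup>2 > 0"
    by (simp add: add_pos_nonneg)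
  then have "stereo_factor x powi (-2) > 0"
    unfolding stereo_factor_def by (intro zero_less_power_int) simp
  then show ?thesis
    using assms by (simp add: punctured_sphere_metric_def scaleR_matrix_vector_assoc[symmetric])
qed

end

theory Submission
  imports Defs
begin

text \<open>Write \<open>S\<close> for \<open>transpose A ** A\<close>, F for
  \<open>stereo_factor x\<close> and L for \<open>stereo_factor (A *v x)\<close>. Both metrics are
  conformal to the flat one, so the energy density is trace S * (F/L)^2 and its gradient is a
  multiple of L x - F S x (\<open>riemannian_grad_energy_density_linear\<close>). The multiple
  vanishes only for A = 0; otherwise the equation reads (1 + |Ax|^2) Ax = (1 + |x|^2) ASx for all x
  (\<open>infinity_harmonic_linear_iff\<close>). Its linear part gives ASx = Ax, and then |Ax| = |x|
  wherever Ax is nonzero (\<open>norm_preserving_of_cubic_identity\<close>). If A is nonzero, its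
  kernel must be trivial, so A preserves all norms (\<open>isometry_of_cubic_identity\<close>),
  which means S = 1. Conversely, S = 1 makes both sides equal.\<close>

lemma Ck_map_const: "Ck_map k (\<lambda>x. c)"
  by (induction k arbitrary: c) simp_all

lemma frechet_derivative_bounded_linear:
  assumes "bounded_linear f"
  shows "frechet_derivative f (at x) = f"
  using bounded_linear_imp_has_derivative[OF assms] frechet_derivative_at by metis

lemma smooth_map_bounded_linear:
  assumes "bounded_linear f"
  shows "smooth_map f"
proof -
  have "f differentiable_on UNIV"
    using assms bounded_linear_imp_differentiable_on by blast
  then have "Ck_map k f" for k
    by (cases k) (simp_all add: Ck_map_const frechet_derivative_bounded_linear[OF assms]
      differentiable_imp_continuous_on)
  then show ?thesis by (simp add: smooth_map_def)
qed

lemma matrix_inv_scaleR_mat: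
  assumes "k \<noteq> 0"
  shows "matrix_inv (k *\<^sub>R (mat 1 :: real ^ 'n ^ 'n)) = inverse k *\<^sub>R mat 1"
  unfolding matrix_inv_def
proof (rule some_equality)
  show "B = inverse k *\<^sub>R mat 1"
    if "(k *\<^sub>R mat 1) ** B = mat 1 \<and> B ** (k *\<^sub>R mat 1) = mat 1" for B :: "real ^ 'n ^ 'n"
  proof -
    have "k *\<^sub>R B = mat 1"
      using that by (simp add: scalar_matrix_assoc[symmetric])
    then show ?thesis
      using assms by (metis scaleR_scaleR left_inverse scaleR_one)
  qed
qed (use assms in \<open>simp add: scalar_matrix_assoc[symmetric]\<close>)

lemma matrix_inner_mult:
  fixes A :: "real ^ 'm ^ 'n"
  shows "(A *v x) \<bullet> (A *v y) = x \<bullet> ((transpose A ** A) *v y)"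
  by (metis dot_lmul_matrix matrix_vector_mul_assoc transpose_matrix_vector transpose_transpose)

text \<open>Polarization: norms determine inner products, and these determine the matrix.\<close>

lemma transpose_mult_eq_mat_iff_isometry:
  fixes A :: "real ^ 'm ^ 'n"
  shows "transpose A ** A = mat 1 \<longleftrightarrow> (\<forall>x. norm (A *v x) = norm x)"
proof
  assume "transpose A ** A = mat 1"
  then show "\<forall>x. norm (A *v x) = norm x"
    by (simp add: norm_eq_sqrt_inner matrix_inner_mult)
next
  assume "\<forall>x. norm (A *v x) = norm x"
  then have "(A *v x) \<bullet> (A *v y) = x \<bullet> y" for x y
    by (simp add: dot_norm matrix_vector_right_distrib[symmetric])
  then have "x \<bullet> ((transpose A ** A) *v y) = x \<bullet> y" for x y
    by (simp only: matrix_inner_mult)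
  then show "transpose A ** A = mat 1"
    by (metis matrix_eq matrix_vector_mul_lid vector_eq_ldot)
qed

lemma stereo_factor_pos: "stereo_factor x > 0"
  by (simp add: stereo_factor_def add_pos_nonneg)

lemma stereo_factor_nonzero [simp]: "stereo_factor x \<noteq> 0"
  using stereo_factor_pos[of x] by simp

lemma pullback_punctured_sphere_metric_linear:
  fixes A :: "real ^ 'm ^ 'n"
  shows "pullback_metric punctured_sphere_metric ((*v) A) x
    = (stereo_factor (A *v x) powi (-2)) *\<^sub>R (transpose A ** A)"
proof -
  have "axis i 1 \<bullet> ((transpose A ** A) *v axis j 1) = (transpose A ** A) $ i $ j" for i j
    by (simp add: inner_axis' matrix_vector_mul_component inner_axis)
  then show ?thesis
    by (simp add: pullback_metric_def frechet_derivative_bounded_linear punctured_sphere_metric_def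
      scaleR_matrix_vector_assoc[symmetric] matrix_inner_mult vec_eq_iff)
qed

lemma energy_density_punctured_sphere_linear:
  fixes A :: "real ^ 'm ^ 'n"
  shows "energy_density punctured_sphere_metric punctured_sphere_metric ((*v) A) x
    = trace (transpose A ** A) * (stereo_factor x / stereo_factor (A *v x))\<^sup>2"
  using stereo_factor_pos[of x]
  by (simp add: energy_density_def pullback_punctured_sphere_metric_linear
    punctured_sphere_metric_def matrix_inv_scaleR_mat scalar_matrix_assoc[symmetric]
    trace_def sum_distrib_left power_int_minus field_simps)

text \<open>The trace is the sum of the squares of all entries of \<open>A\<close>. This decides
  when the scalar factor of the gradient may be cancelled.\<close>

lemma trace_transpose_mult_eq_0_iff:
  fixes A :: "real ^ 'm ^ 'n"
  shows "trace (transpose A ** A) = 0 \<longleftrightarrow> A = 0"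
proof
  assume "trace (transpose A ** A) = 0"
  then have "(\<Sum>i\<in>UNIV. \<Sum>k\<in>UNIV. A $ k $ i * A $ k $ i) = 0"
    by (simp add: trace_def matrix_matrix_mult_def transpose_def)
  then show "A = 0"
    by (simp add: sum_nonneg_eq_0_iff sum_nonneg vec_eq_iff)
qed (simp add: trace_def)

text \<open>The Euclidean gradients of F and L are x and S x, the latter by the chain rule. The
  inverse metric contributes a further F^2, hence the cube of F.\<close>

lemma riemannian_grad_energy_density_linear:
  fixes A :: "real ^ 'm ^ 'n"
  defines "S \<equiv> transpose A ** A"
  shows "riemannian_grad punctured_sphere_metric
      (energy_density punctured_sphere_metric punctured_sphere_metric ((*v) A)) x
    = (2 * trace S * stereo_factor x ^ 3 / stereo_factor (A *v x) ^ 3) *\<^sub>R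
        (stereo_factor (A *v x) *\<^sub>R x - stereo_factor x *\<^sub>R (S *v x))"
proof -
  let ?F = "stereo_factor x" and ?L = "stereo_factor (A *v x)"
  \<comment> \<open>The differential of trace S * (F/L)^2, by the quotient rule.\<close>
  define D where "D v = trace S * (2 * (?F / ?L) *
      ((x \<bullet> v) * ?L - ?F * ((S *v x) \<bullet> v)) / ?L\<^sup>2)" for v
  have pos: "?F > 0" "?L > 0" by (rule stereo_factor_pos)+
  have "((\<lambda>x. stereo_factor x) has_derivative (\<lambda>v. x \<bullet> v)) (at x)" for x :: "real ^ 'k"
    unfolding stereo_factor_def power2_norm_eq_inner
    by (auto intro!: derivative_eq_intros simp: inner_commute)
  note sf = this
  have dL: "((\<lambda>x. stereo_factor (A *v x)) has_derivative (\<lambda>v. (S *v x) \<bullet> v)) (at x)"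
    using has_derivative_compose[OF bounded_linear_imp_has_derivative[OF matrix_vector_mul_bounded_linear[of A]] sf[of "A *v x"]]
    by (simp add: matrix_inner_mult S_def inner_commute)
  have "(energy_density punctured_sphere_metric punctured_sphere_metric ((*v) A) has_derivative D) (at x)"
    unfolding energy_density_punctured_sphere_linear[abs_def] S_def[symmetric] D_def[abs_def]
    using pos
    by (auto intro!: derivative_eq_intros sf dL simp: power2_eq_square field_simps)
  then have "frechet_derivative (energy_density punctured_sphere_metric punctured_sphere_metric ((*v) A)) (at x) = D"
    by (metis frechet_derivative_at)
  then show ?thesis
    using pos
    by (simp add: riemannian_grad_def punctured_sphere_metric_def matrix_inv_scaleR_mat
      scaleR_matrix_vector_assoc[symmetric] D_def vec_eq_iff inner_axis power_int_minus)
      (simp add: field_simps power2_eq_square power3_eq_cube)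
qed

text \<open>Apply \<open>A\<close> to the gradient and drop its scalar factor, which is nonzero
  unless trace S = 0. The 1/2 in both stereographic factors cancels.\<close>

lemma infinity_harmonic_linear_iff:
  fixes A :: "real ^ 'm ^ 'n"
  defines "S \<equiv> transpose A ** A"
  shows "infinity_harmonic punctured_sphere_metric punctured_sphere_metric ((*v) A) \<longleftrightarrow>
    A = 0 \<or> (\<forall>x. (1 + (norm (A *v x))\<^sup>2) *\<^sub>R (A *v x) = (1 + (norm x)\<^sup>2) *\<^sub>R (A *v (S *v x)))"
proof -
  have eq: "A *v (c *\<^sub>R (stereo_factor (A *v x) *\<^sub>R x - stereo_factor x *\<^sub>R (S *v x))) =
     (c / 2) *\<^sub>R ((1 + (norm (A *v x))\<^sup>2) *\<^sub>R (A *v x) - (1 + (norm x)\<^sup>2) *\<^sub>R (A *v (S *v x)))" for c x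
    by (simp add: stereo_factor_def matrix_vector_mult_diff_distrib matrix_vector_mult_scaleR
      scaleR_diff_right)
  show ?thesis
    by (auto simp: infinity_harmonic_def smooth_map_bounded_linear frechet_derivative_bounded_linear
      riemannian_grad_energy_density_linear S_def[symmetric] eq
      trace_transpose_mult_eq_0_iff[of A, folded S_def])
qed

text \<open>Along a line \<open>t *\<^sub>R x\<close> the equation is a cubic polynomial identity in \<open>t\<close>, so its linear and
  cubic parts agree separately; comparing \<open>t = 1\<close> and \<open>t = 2\<close> already isolates the linear part.\<close>

lemma norm_preserving_of_cubic_identity:
  fixes A :: "real ^ 'm ^ 'n"
  assumes eq: "\<And>x. (1 + (norm (A *v x))\<^sup>2) *\<^sub>R (A *v x) = (1 + (norm x)\<^sup>2) *\<^sub>R (A *v (S *v x))"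
    and "A *v x \<noteq> 0"
  shows "norm (A *v x) = norm x"
proof -
  let ?u = "A *v x" and ?w = "A *v (S *v x)"
  have 1: "(1 + (norm ?u)\<^sup>2) *\<^sub>R ?u = (1 + (norm x)\<^sup>2) *\<^sub>R ?w"
    by (rule eq)
  have *: "2 *\<^sub>R ((1 + 4 * (norm ?u)\<^sup>2) *\<^sub>R ?u) = 2 *\<^sub>R ((1 + 4 * (norm x)\<^sup>2) *\<^sub>R ?w)"
    using eq[of "2 *\<^sub>R x"]
    by (simp add: matrix_vector_mult_scaleR power_mult_distrib)
  have 2: "(1 + 4 * (norm ?u)\<^sup>2) *\<^sub>R ?u = (1 + 4 * (norm x)\<^sup>2) *\<^sub>R ?w"
    using scaleR_left_imp_eq[OF _ *] by simp
  \<comment> \<open>Four times the identity at \<open>x\<close> minus the halved identity at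
    \<open>2 *\<^sub>R x\<close> cancels the cubic terms.\<close>
  have "3 *\<^sub>R ?u = 4 *\<^sub>R ((1 + (norm ?u)\<^sup>2) *\<^sub>R ?u) - (1 + 4 * (norm ?u)\<^sup>2) *\<^sub>R ?u"
    by (simp add: vec_eq_iff algebra_simps)
  also have "\<dots> = 3 *\<^sub>R ?w"
    unfolding 1 2 by (simp add: vec_eq_iff algebra_simps)
  finally have "?w = ?u" by simp
  from 1[unfolded this] assms(2) have "(norm ?u)\<^sup>2 = (norm x)\<^sup>2" by simp
  then show ?thesis by simp
qed

lemma isometry_of_cubic_identity:
  fixes A :: "real ^ 'm ^ 'n"
  assumes "\<And>x. (1 + (norm (A *v x))\<^sup>2) *\<^sub>R (A *v x) = (1 + (norm x)\<^sup>2) *\<^sub>R (A *v (S *v x))"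
    and "A \<noteq> 0"
  shows "norm (A *v x) = norm x"
proof (cases "A *v x = 0")
  case True
  \<comment> \<open>Adding a kernel vector to \<open>y\<close> must not change its norm, which forces that vector to be 0.\<close>
  obtain y where y: "A *v y \<noteq> 0"
    using \<open>A \<noteq> 0\<close> by (metis matrix_eq matrix_vector_mult_0)
  have eq: "A *v (y + x) = A *v y" "A *v (y - x) = A *v y"
    by (simp_all add: matrix_vector_right_distrib matrix_vector_mult_diff_distrib True)
  note norm_eq = norm_preserving_of_cubic_identity[OF assms(1)]
  have "norm (y + x) = norm y" "norm (y - x) = norm y"
    using norm_eq[of "y + x"] norm_eq[of "y - x"] norm_eq[of y] y by (simp_all add: eq)
  \<comment> \<open>The squared equalities say that x.x + 2 x.y and x.x - 2 x.y both vanish; add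
    them.\<close>
  then have "x \<bullet> x = 0"
    by (simp add: norm_eq_sqrt_inner inner_simps inner_commute)
  then show ?thesis using True by simp
next
  case False
  then show ?thesis by (rule norm_preserving_of_cubic_identity[OF assms(1)])
qed

text \<open>At the origin both conformal factors agree, since \<open>A\<close> fixes 0, so the
  metric condition there is already S = 1. Conversely, S = 1 preserves norms, so the factors agree
  at every point.\<close>

lemma isometric_immersion_linear_iff:
  fixes A :: "real ^ 'm ^ 'n"
  shows "isometric_immersion punctured_sphere_metric punctured_sphere_metric ((*v) A) \<longleftrightarrow>
    transpose A ** A = mat 1"
proof
  assume "isometric_immersion punctured_sphere_metric punctured_sphere_metric ((*v) A)"
  then have "pullback_metric punctured_sphere_metric ((*v) A) 0 = punctured_sphere_metric 0"
    by (simp add: isometric_immersion_def)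
  then show "transpose A ** A = mat 1"
    by (simp add: pullback_punctured_sphere_metric_linear punctured_sphere_metric_def
      stereo_factor_def)
next
  assume S: "transpose A ** A = mat 1"
  then have iso: "norm (A *v x) = norm x" for x
    by (simp add: transpose_mult_eq_mat_iff_isometry)
  then have "inj ((*v) A)"
    by (metis S matrix_left_invertible_injective)
  with S iso show "isometric_immersion punctured_sphere_metric punctured_sphere_metric ((*v) A)"
    by (simp add: isometric_immersion_def smooth_map_bounded_linear
      frechet_derivative_bounded_linear pullback_punctured_sphere_metric_linear
      punctured_sphere_metric_def stereo_factor_def)
qed

theorem theorem3p2:
  fixes A :: "real ^ 'm ^ 'n" and \<phi> :: "real ^ 'm \<Rightarrow> real ^ 'n"
  assumes "\<And>X. \<phi> X = A *v X"
  shows "(infinity_harmonic punctured_sphere_metric punctured_sphere_metric \<phi> \<longleftrightarrow>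
            A = 0 \<or> transpose A ** A = mat 1) \<and>
         (A = 0 \<longleftrightarrow> \<phi> constant_on UNIV) \<and>
         (transpose A ** A = mat 1 \<longleftrightarrow>
            isometric_immersion punctured_sphere_metric punctured_sphere_metric \<phi>)"
proof -
  have \<phi>: "\<phi> = (*v) A" using assms by auto
  define S where "S = transpose A ** A"
  have "A = 0 \<or> S = mat 1"
    if "\<And>x. (1 + (norm (A *v x))\<^sup>2) *\<^sub>R (A *v x) = (1 + (norm x)\<^sup>2) *\<^sub>R (A *v (S *v x))"
    using isometry_of_cubic_identity[OF that] by (auto simp: S_def transpose_mult_eq_mat_iff_isometry)
  moreover have "(1 + (norm (A *v x))\<^sup>2) *\<^sub>R (A *v x) = (1 + (norm x)\<^sup>2) *\<^sub>R (A *v (S *v x))"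
    if "S = mat 1" for x
  proof -
    have "norm (A *v x) = norm x"
      using that unfolding S_def transpose_mult_eq_mat_iff_isometry by blast
    then show ?thesis by (simp add: that)
  qed
  moreover have "A = 0 \<longleftrightarrow> (*v) A constant_on UNIV"
  proof
    assume "(*v) A constant_on UNIV"
    then obtain c where c: "A *v x = c" for x
      by (auto simp: constant_on_def)
    then have "A *v x = 0 *v x" for x
      using c[of 0] by simp
    then show "A = 0" by (simp add: matrix_eq)
  qed (simp add: constant_on_def)
  ultimately show ?thesis
    unfolding \<phi> infinity_harmonic_linear_iff isometric_immersion_linear_iff S_def[symmetric] by blast
qed

end
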